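(* Let $d\geqslant3$ be an integer, let $W_d^{k=1}$ be the complete generalised Wronskian of first differential order over $\mathbb{R}^d$ with coordinates $x^1,\ldots,x^d$, and let $F_n$ be the Fibonacci numbers. Then for every integer $n\geqslant d-1$, $$W_d^{k=1}\Bigl(1,\,x^1,\ldots,x^{d-3},\;x^{d-2}x^{d-1}x^d,\;\prod_{i=1}^d(x^i)^{F_{n-i+1}},\;\prod_{i=1}^d(x^i)^{F_{n-i+2}}\Bigr)=(-1)^{n-d}\prod_{i=1}^d(x^i)^{F_{n-i+3}}.$$ (For $d=3$ the list $x^1,\ldots,x^{d-3}$ is empty.)
   Context: Superscripts on $x^i$ without parentheses are coordinate indices; $(x^i)^m$ is the $m$th power of the coordinate $x^i$. For $N=d+1$ functions $f_1,\ldots,f_{d+1}$ on $\mathbb{R}^d$, $W_d^{k=1}(f_1,\ldots,f_{d+1})$ is the determinant of the $(d+1)\times(d+1)$ matrix whose first row is $(f_1,\ldots,f_{d+1})$ and whose $(i+1)$st row is $(\partial f_1/\partial x^i,\ldots,\partial f_{d+1}/\partial x^i)$ for $i=1,\ldots,d$. The Fibonacci numbers are $F_0=0$, $F_1=1$, $F_n=F_{n-1}+F_{n-2}$ for $n\geqslant2$. *)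

theory Defs
  imports
    "HOL-Analysis.Derivative"
    "HOL-Number_Theory.Fib"
    "Jordan_Normal_Form.Determinant"
begin

text \<open>
  Since the dimension varies, points of real \<open>d\<close>-space are real families indexed by the set
  \<open>{1..d}\<close> (extensional functions), so \<open>x i\<close> is the coordinate with upper index \<open>i\<close>.
\<close>

definition Rspace :: "nat \<Rightarrow> (nat \<Rightarrow> real) set" where
  "Rspace d = ({1..d} \<rightarrow>\<^sub>E (UNIV :: real set))"

definition partial_deriv :: "nat \<Rightarrow> ((nat \<Rightarrow> real) \<Rightarrow> real) \<Rightarrow> (nat \<Rightarrow> real) \<Rightarrow> real" where
  "partial_deriv i f x = deriv (\<lambda>t. f (x(i := t))) (x i)"

text \<open>
  Matrix indices start at 0: row 0 holds the functions themselves and row \<open>i\<close>, for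
  \<open>1 \<le> i \<le> d\<close>, their partial derivatives in direction \<open>i\<close>. The list is meant to have
  length \<open>d + 1\<close>.
\<close>

definition wronskian1 ::
    "nat \<Rightarrow> ((nat \<Rightarrow> real) \<Rightarrow> real) list \<Rightarrow> (nat \<Rightarrow> real) \<Rightarrow> real" where
  "wronskian1 d fs x =
     Determinant.det (mat (d + 1) (d + 1)
       (\<lambda>(i, j). if i = 0 then (fs ! j) x else partial_deriv i (fs ! j) x))"

end

theory Submission
  imports Defs
begin

text \<open>
  The first \<open>d - 2\<close> functions are \<open>1\<close> and the coordinates \<open>x\<^sup>1, \<dots>, x\<^sup>d\<^sup>-\<^sup>3\<close>, so their columns are
  upper triangular with unit diagonal and the Wronskian collapses to the Jacobian of the last three
  functions \<open>u\<close>, \<open>f\<close>, \<open>g\<close> in the last three variables \<open>p\<close>, \<open>q\<close>, \<open>r\<close>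
  (\<open>wronskian1_reduce_to_3\<close>).  Since \<open>u = p q r\<close> has derivatives \<open>q r\<close>, \<open>p r\<close>, \<open>p q\<close>,
  each term of this Jacobian pairs every derivative of a monomial with the
  variable in whose direction it is taken.  Euler's relation \<open>p \<partial>f/\<partial>p = a f\<close>, where \<open>a\<close> is the
  exponent of \<open>p\<close> in \<open>f\<close>, then shows that the Jacobian is \<open>f g\<close> times the determinant with rows
  \<open>(1, a, a')\<close>, \<open>(1, b, b')\<close>, \<open>(1, c, c')\<close> formed from the exponents of \<open>f\<close> and \<open>g\<close>.  Nothing is divided
  by a coordinate, so points with vanishing coordinates need no separate treatment.

  By the Fibonacci recursion the exponents add up in \<open>f g\<close> to those on the right-hand side,
  and the determinant of exponents is \<open>F\<^sub>m\<^sub>+\<^sub>2 F\<^sub>m - F\<^sub>m\<^sub>+\<^sub>1\<^sup>2\<close> with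
  \<open>m = n - d + 1\<close>, which Cassini's identity evaluates to the sign.
\<close>

lemma det_3:
  fixes A :: "'a :: comm_ring_1 mat"
  assumes "A \<in> carrier_mat 3 3"
  shows "Determinant.det A =
     A $$ (0,0) * (A $$ (1,1) * A $$ (2,2) - A $$ (1,2) * A $$ (2,1))
   - A $$ (0,1) * (A $$ (1,0) * A $$ (2,2) - A $$ (1,2) * A $$ (2,0))
   + A $$ (0,2) * (A $$ (1,0) * A $$ (2,1) - A $$ (1,1) * A $$ (2,0))"
proof -
  have det2: "Determinant.det B = B $$ (0,0) * B $$ (1,1) - B $$ (0,1) * B $$ (1,0)"
    if "B \<in> carrier_mat 2 2" for B :: "'a mat"
    using that
    by (subst laplace_expansion_row[of B 2 0])
       (auto simp: cofactor_def mat_delete_def det_single eval_nat_numeral)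
  show ?thesis
    using assms
    by (subst laplace_expansion_row[of A 3 0])
       (auto simp: cofactor_def mat_delete_def det2 eval_nat_numeral algebra_simps)
qed

lemma partial_deriv_const: "partial_deriv i (\<lambda>y. c) x = 0"
  by (simp add: partial_deriv_def)

lemma partial_deriv_coordinate: "partial_deriv i (\<lambda>y. y j) x = (if i = j then 1 else 0)"
  by (simp add: partial_deriv_def)

text \<open>Euler's relation for a monomial, one coordinate at a time.\<close>

lemma times_partial_deriv_monomial:
  assumes "finite I" "k \<in> I"
  shows "x k * partial_deriv k (\<lambda>y. \<Prod>i\<in>I. y i ^ e i) x = real (e k) * (\<Prod>i\<in>I. x i ^ e i)"
proof -
  define c where "c = (\<Prod>i\<in>I - {k}. x i ^ e i)"
  have split: "(\<Prod>i\<in>I. (x(k := t)) i ^ e i) = t ^ e k * c" for t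
    unfolding c_def prod.remove[OF assms] by (auto intro!: prod.cong)
  have "partial_deriv k (\<lambda>y. \<Prod>i\<in>I. y i ^ e i) x = real (e k) * x k ^ (e k - 1) * c"
    unfolding partial_deriv_def split
    by (rule DERIV_imp_deriv) (auto intro!: derivative_eq_intros)
  moreover have "(\<Prod>i\<in>I. x i ^ e i) = x k ^ e k * c"
    using split[of "x k"] by simp
  ultimately show ?thesis
    by (cases "e k") auto
qed

text \<open>
  The columns of the constant and of the first coordinates form the left half of a block upper
  triangular matrix; the lower right block is the Jacobian in the remaining three variables.
\<close>

lemma wronskian1_reduce_to_3:
  assumes "d \<ge> 3"
  shows "wronskian1 d ([\<lambda>y. 1] @ map (\<lambda>i y. y i) [1..<d - 2] @ [u, f, g]) x =
    Determinant.det (mat 3 3 (\<lambda>(i, j). partial_deriv (d - 2 + i) ([u, f, g] ! j) x))"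
proof -
  define fs where "fs = [\<lambda>y. 1] @ map (\<lambda>i y. y i) [1..<d - 2] @ [u, f, g]"
  define h where "h = (\<lambda>(i, j). if i = 0 then (fs ! j) x else partial_deriv i (fs ! j) x)"
  define k where "k = d - 2"
  have k: "d + 1 = k + 3" "k \<ge> 1" using assms by (auto simp: k_def)
  have fs_0: "fs ! 0 = (\<lambda>y. 1)" by (simp add: fs_def)
  have fs_coordinate: "fs ! j = (\<lambda>y. y j)" if "0 < j" "j < k" for j
    using that by (cases j) (auto simp: fs_def k_def nth_append)
  have fs_last: "fs ! (k + j) = [u, f, g] ! j" for j
  proof -
    have "length ([\<lambda>y. 1] @ map (\<lambda>i y. y i) [1..<d - 2]) = k"
      using assms by (auto simp: k_def)
    then show ?thesis
      unfolding fs_def append_assoc[symmetric] by (metis nth_append_length_plus)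
  qed
  have left: "h (i, j) = (if i = j then 1 else 0)" if "j \<le> i" "j < k" for i j
    using that fs_0 fs_coordinate[of j]
    by (cases "j = 0") (auto simp: h_def partial_deriv_const partial_deriv_coordinate)
  define A where "A = mat k k h"
  define B where "B = mat k 3 (\<lambda>(i, j). h (i, k + j))"
  define D where "D = mat 3 3 (\<lambda>(i, j). h (k + i, k + j))"
  have "mat (d + 1) (d + 1) h = four_block_mat A B (0\<^sub>m 3 k) D"
    unfolding k(1) by (rule eq_matI) (auto simp: A_def B_def D_def left)
  then have "wronskian1 d fs x = Determinant.det (four_block_mat A B (0\<^sub>m 3 k) D)"
    by (simp only: wronskian1_def h_def)
  also have "\<dots> = Determinant.det A * Determinant.det D"
    by (rule det_four_block_mat_lower_left_zero) (auto simp: A_def B_def D_def)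
  also have "Determinant.det A = prod_list (diag_mat A)"
    by (rule det_upper_triangular[of _ k]) (auto simp: A_def left upper_triangular_def)
  also have "diag_mat A = replicate k 1"
    by (rule nth_equalityI) (auto simp: A_def diag_mat_def left)
  also have "D = mat 3 3 (\<lambda>(i, j). partial_deriv (k + i) ([u, f, g] ! j) x)"
    using k(2) by (intro eq_matI) (auto simp: D_def h_def fs_last)
  finally show ?thesis
    by (simp add: fs_def k_def)
qed

text \<open>
  With \<open>(c, b, a)\<close> and \<open>(c', b', a') = (b, a, a + b)\<close> consecutive Fibonacci numbers, the determinant
  of exponents is \<open>a c - b\<^sup>2\<close>.
\<close>

lemma fib_exponent_det:
  fixes m :: nat
  defines "F \<equiv> \<lambda>k. real (fib k)"
  shows "(F (m+1) * F (m+1) - F m * F (m+2)) - (F (m+2) * F (m+1) - F m * F (m+3))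
       + (F (m+2) * F (m+2) - F (m+1) * F (m+3)) = - ((- 1) ^ m)"
proof -
  have "real_of_int (int (fib (Suc (Suc m)) * fib m) - int ((fib (Suc m))\<^sup>2)) = - ((- 1) ^ m)"
    unfolding fib_Cassini_int by simp
  then have "F (m+2) * F m - F (m+1) * F (m+1) = - ((- 1) ^ m)"
    by (simp add: F_def power2_eq_square)
  moreover have "F (m+2) = F (m+1) + F m" "F (m+3) = F (m+2) + F (m+1)"
    by (simp_all add: F_def eval_nat_numeral)
  ultimately show ?thesis
    by (simp add: algebra_simps)
qed

theorem mainTheorem4:
  fixes d n :: nat and x :: "nat \<Rightarrow> real"
  assumes "d \<ge> 3" and "n \<ge> d - 1" and "x \<in> Rspace d"
  shows "wronskian1 d
           ([\<lambda>y. 1] @ map (\<lambda>i y. y i) [1..<d - 2] @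
            [\<lambda>y. y (d - 2) * y (d - 1) * y d,
             \<lambda>y. \<Prod>i = 1..d. y i ^ fib (n + 1 - i),
             \<lambda>y. \<Prod>i = 1..d. y i ^ fib (n + 2 - i)]) x
         = (- 1) powi (int n - int d) * (\<Prod>i = 1..d. x i ^ fib (n + 3 - i))"
proof -
  define m where "m = n + 1 - d"
  define F where "F = (\<lambda>k. real (fib k))"
  define f where "f = (\<lambda>y :: nat \<Rightarrow> real. \<Prod>i = 1..d. y i ^ fib (n + 1 - i))"
  define g where "g = (\<lambda>y :: nat \<Rightarrow> real. \<Prod>i = 1..d. y i ^ fib (n + 2 - i))"
  define u where "u = (\<lambda>y :: nat \<Rightarrow> real. y (d - 2) * y (d - 1) * y d)"
  define p q r where "p = x (d - 2)" and "q = x (d - 1)" and "r = x d"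
  define P where "P = partial_deriv (d - 2)"
  define Q where "Q = partial_deriv (d - 1)"
  define R where "R = partial_deriv d"

  have u: "P u x = q * r" "Q u x = p * r" "R u x = p * q"
  proof -
    have ne: "d - 2 \<noteq> d - 1" "d - 2 \<noteq> d" "d - 1 \<noteq> d"
      using assms(1) by auto
    have D: "deriv (\<lambda>t. t * q * r) p = q * r" "deriv (\<lambda>t. p * t * r) q = p * r"
      "deriv (\<lambda>t. p * q * t) r = p * q"
      by (rule DERIV_imp_deriv; auto intro!: derivative_eq_intros)+
    show "P u x = q * r" "Q u x = p * r" "R u x = p * q"
      using ne D by (simp_all add: P_def Q_def R_def u_def p_def q_def r_def partial_deriv_def)
  qed
  have euler_f: "x k * partial_deriv k f x = F (n + 1 - k) * f x"
   and euler_g: "x k * partial_deriv k g x = F (n + 2 - k) * g x" if "k \<in> {1..d}" for k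
    unfolding f_def g_def F_def using that by (auto intro!: times_partial_deriv_monomial)
  have idx: "n + 1 - (d - 2) = m + 2" "n + 1 - (d - 1) = m + 1" "n + 1 - d = m"
    "n + 2 - (d - 2) = m + 3" "n + 2 - (d - 1) = m + 2" "n + 2 - d = m + 1"
    using assms(1,2) by (auto simp: m_def)
  have ef: "p * P f x = F (m + 2) * f x" "q * Q f x = F (m + 1) * f x" "r * R f x = F m * f x"
    using euler_f[of "d - 2"] euler_f[of "d - 1"] euler_f[of d] assms(1)
    unfolding idx p_def q_def r_def P_def Q_def R_def by auto
  have eg: "p * P g x = F (m + 3) * g x" "q * Q g x = F (m + 2) * g x"
    "r * R g x = F (m + 1) * g x"
    using euler_g[of "d - 2"] euler_g[of "d - 1"] euler_g[of d] assms(1)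
    unfolding idx p_def q_def r_def P_def Q_def R_def by auto

  have "wronskian1 d ([\<lambda>y. 1] @ map (\<lambda>i y. y i) [1..<d - 2] @ [u, f, g]) x =
      P u x * (Q f x * R g x - Q g x * R f x) - P f x * (Q u x * R g x - Q g x * R u x)
      + P g x * (Q u x * R f x - Q f x * R u x)"
  proof -
    have "d - 2 + 1 = d - 1" "d - 2 + 2 = d" using assms(1) by auto
    then show ?thesis
      unfolding wronskian1_reduce_to_3[OF assms(1)] by (simp add: det_3 P_def Q_def R_def)
  qed
  \<comment> \<open>Expand along the column of \<open>u\<close>, matching each derivative with its own variable.\<close>
  also have "\<dots> = ((q * Q f x) * (r * R g x) - (q * Q g x) * (r * R f x))
      - ((p * P f x) * (r * R g x) - (p * P g x) * (r * R f x))
      + ((p * P f x) * (q * Q g x) - (p * P g x) * (q * Q f x))"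
    unfolding u by (simp add: algebra_simps)
  also have "\<dots> = ((F (m+1) * F (m+1) - F m * F (m+2)) - (F (m+2) * F (m+1) - F m * F (m+3))
       + (F (m+2) * F (m+2) - F (m+1) * F (m+3))) * (f x * g x)"
    unfolding ef eg by (simp add: algebra_simps)
  also have "\<dots> = - ((- 1) ^ m) * (f x * g x)"
    unfolding F_def fib_exponent_det ..
  also have "f x * g x = (\<Prod>i = 1..d. x i ^ fib (n + 3 - i))"
  proof -
    have "fib (n + 3 - i) = fib (n + 1 - i) + fib (n + 2 - i)" if "i \<in> {1..d}" for i
    proof -
      from that assms(1,2) have "n + 3 - i = Suc (Suc (n + 1 - i))" "n + 2 - i = Suc (n + 1 - i)"
        by auto
      then show ?thesis by simp
    qed
    then show ?thesis
      unfolding f_def g_def prod.distrib[symmetric] by (intro prod.cong) (auto simp: power_add)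
  qed
  \<comment> \<open>The exponent \<open>n - d\<close> is \<open>-1\<close> when \<open>m = 0\<close>, hence the integer power.\<close>
  also have "- ((- 1) ^ m) = ((- 1) powi (int n - int d) :: real)"
  proof -
    have "int n - int d = int m - 1" using assms(1,2) by (auto simp: m_def)
    then show ?thesis by (simp add: power_int_diff)
  qed
  finally show ?thesis
    unfolding u_def f_def g_def .
qed

end
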